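(* Let $n,m\ge 1$ be integers, $s=n+m-1$, $N=\binom{s+2}{2}$, and let $h_1,\dots,h_K$ be the data polynomials of a rank-1 matrix completion problem with true value $\mathbf{z}_0\in\mathbb{R}^s$ (as defined in the context), $d_k=\deg h_k$. For $r\in\{2,\dots,N\}$ let $Q^r$ be the $N\times N$ symmetric positive semidefinite matrix whose only possibly nonzero entries are $$[Q^r]_{11}=\left((\mathbf{z}_0)_{i(r)}\right)^2\left((\mathbf{z}_0)_{j(r)}\right)^2,\qquad [Q^r]_{1r}=[Q^r]_{r1}=-(\mathbf{z}_0)_{i(r)}(\mathbf{z}_0)_{j(r)},\qquad [Q^r]_{rr}=1,$$ and let $Q:=\sum_{r=2}^N Q^r$. For any $\rho\in\mathbb{R}$ and any $\lambda_k(\mathbf{z})\in\Sigma_{4-2d_k}[\mathbf{z}]$ $(k=1,\dots,K)$ such that $$q(\mathbf{z};Q;\rho,\boldsymbol{\lambda}):=\mathbf{u}_2^{T} Q\,\mathbf{u}_2-\rho+\sum_{k=1}^K h_k(\mathbf{z})^2\lambda_k(\mathbf{z})$$ is a sum-of-squares polynomial, the rank of the Gram matrix $\Gamma\in\mathbb{S}^N_+$ for $q(\mathbf{z};Q;\rho,\boldsymbol{\lambda})$, i.e., of $\Gamma\in\mathbb{S}^N_+$ with $\mathbf{u}_2^{T}\Gamma\,\mathbf{u}_2=q(\mathbf{z};Q;\rho,\boldsymbol{\lambda})$, is greater than or equal to $N-1$.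
   Context: Setting: $\mathbf{x}_0\in\mathbb{R}^n$ with $(\mathbf{x}_0)_1=1$ and $\mathbf{y}_0\in\mathbb{R}^m$ are the true factors of a rank-1 matrix $X_0=\mathbf{x}_0\mathbf{y}_0^T$. The variables are $\mathbf{z}=(z_1,\dots,z_s)=(x_2,\dots,x_n,y_1,\dots,y_m)$, with $x_1:=1$, and $\mathbf{z}_0=((\mathbf{x}_0)_2,\dots,(\mathbf{x}_0)_n,(\mathbf{y}_0)_1,\dots,(\mathbf{y}_0)_m)$. The known entries are indexed by a set $\Lambda\subseteq\{1,\dots,n\}\times\{1,\dots,m\}$ with $|\Lambda|=K$; the data polynomials $h_1,\dots,h_K$ are the polynomials $x_iy_j-(\mathbf{x}_0)_i(\mathbf{y}_0)_j$ for $(i,j)\in\Lambda$ (so $h_k$ has degree $d_k=1$ if $i=1$ and $d_k=2$ otherwise, and $h_k(\mathbf{z}_0)=0$). $\mathbf{u}_2=\mathbf{u}_2(\mathbf{z})$ is the vector of all $N$ monomials of degree at most $2$ in $\mathbf{z}$, in a fixed order with first entry $1$. For each $r$, $z_{i(r)}$ and $z_{j(r)}$ denote monomials of degree $0$ or $1$ with $(\mathbf{u}_2)_r=z_{i(r)}z_{j(r)}$, and $(\mathbf{z}_0)_{i(r)}$, $(\mathbf{z}_0)_{j(r)}$ are their values at $\mathbf{z}=\mathbf{z}_0$ (equal to $1$ for the degree-$0$ monomial), so that $(\mathbf{z}_0)_{i(r)}(\mathbf{z}_0)_{j(r)}$ is the $r$-th entry of $\mathbf{u}_2(\mathbf{z}_0)$.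 $\mathbb{S}^N_+$ is the set of real symmetric positive semidefinite $N\times N$ matrices. $\Sigma_{2d}[\mathbf{z}]$ denotes the set of finite sums $\sum_j q_j(\mathbf{z})^2$ with $q_j$ real polynomials of degree at most $d$. For a polynomial $p$ of degree at most $4$ that is a sum of squares, a matrix $W\in\mathbb{S}^N_+$ with $p(\mathbf{z})=\mathbf{u}_2^{T}W\mathbf{u}_2$ is called the Gram matrix of $p$.
   Formalization: Gram matrices are not unique and the bound fails for some of them (n=m=1, z_0=1, Λ={(1,1)}, ρ=-4, λ=3y²-10y+10 gives q=(2y²-4y+4)², rank 1 < 2); the formal statement says that q has some positive semidefinite Gram matrix Γ of rank at least N-1. *)

theory Defs
  imports
    "HOL-Library.Poly_Mapping"
    "Jordan_Normal_Form.Matrix"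
    "Jordan_Normal_Form.DL_Rank"
begin

text \<open>
  Real polynomials are finitely supported maps from exponent vectors to coefficients, with the
  (convolution) ring structure of \<^theory>\<open>HOL-Library.Poly_Mapping\<close>.
  All indices are zero-based: the variables \<open>z\<^sub>1, \<dots>, z\<^sub>s\<close> are \<open>Var 0, \<dots>, Var (s - 1)\<close>, and rows and
  columns of matrices and entries of vectors start at \<open>0\<close>, as in \<^theory>\<open>Jordan_Normal_Form.Matrix\<close>.
\<close>

type_synonym real_mpoly = "(nat \<Rightarrow>\<^sub>0 nat) \<Rightarrow>\<^sub>0 real"

definition Const :: "real \<Rightarrow> real_mpoly" where
  "Const c = Poly_Mapping.single 0 c"

definition Var :: "nat \<Rightarrow> real_mpoly" where
  "Var i = Poly_Mapping.single (Poly_Mapping.single i 1) 1"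

definition exponent_degree :: "(nat \<Rightarrow>\<^sub>0 nat) \<Rightarrow> nat" where
  "exponent_degree t = (\<Sum>i\<in>Poly_Mapping.keys t. Poly_Mapping.lookup t i)"

text \<open>The zero polynomial gets degree \<open>0\<close>.\<close>

definition total_degree :: "real_mpoly \<Rightarrow> nat" where
  "total_degree p = Max (insert 0 (exponent_degree ` Poly_Mapping.keys p))"

definition polys :: "nat \<Rightarrow> real_mpoly set" where
  "polys s = {p. \<forall>t\<in>Poly_Mapping.keys p. Poly_Mapping.keys t \<subseteq> {..<s}}"

definition monomials_upto :: "nat \<Rightarrow> nat \<Rightarrow> real_mpoly set" where
  "monomials_upto s d =
     {Poly_Mapping.single t 1 | t. Poly_Mapping.keys t \<subseteq> {..<s} \<and> exponent_degree t \<le> d}"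

definition poly_eval :: "real vec \<Rightarrow> real_mpoly \<Rightarrow> real" where
  "poly_eval z p =
     (\<Sum>t\<in>Poly_Mapping.keys p. Poly_Mapping.lookup p t *
        (\<Prod>i\<in>Poly_Mapping.keys t. (z $ i) ^ Poly_Mapping.lookup t i))"

definition sos_polys :: "nat \<Rightarrow> real_mpoly set" where
  "sos_polys s = {p. \<exists>qs. set qs \<subseteq> polys s \<and> p = (\<Sum>q\<leftarrow>qs. q\<^sup>2)}"

text \<open>\<open>sos_polys_deg s e\<close> is \<open>\<Sigma>\<^sub>e[z]\<close> (for even \<open>e\<close>): the summands are squares of polynomials of
  degree at most \<open>e / 2\<close>.\<close>

definition sos_polys_deg :: "nat \<Rightarrow> nat \<Rightarrow> real_mpoly set" where
  "sos_polys_deg s e =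
     {p. \<exists>qs. set qs \<subseteq> {q \<in> polys s. 2 * total_degree q \<le> e} \<and> p = (\<Sum>q\<leftarrow>qs. q\<^sup>2)}"

definition psd_mats :: "nat \<Rightarrow> real mat set" where
  "psd_mats N =
     {W \<in> carrier_mat N N. transpose_mat W = W \<and> (\<forall>v\<in>carrier_vec N. 0 \<le> v \<bullet> (W *\<^sub>v v))}"

text \<open>\<open>u\<^sup>T W u\<close> as a formal polynomial, for a vector \<open>u\<close> of polynomials.\<close>

definition quad_form :: "real_mpoly vec \<Rightarrow> real mat \<Rightarrow> real_mpoly" where
  "quad_form u W = u \<bullet> (map_mat Const W *\<^sub>v u)"

text \<open>
  Gram matrices with respect to the vector \<open>u\<close> of all monomials of degree at most \<open>2\<close> are not unique:
  the products \<open>u $ a * u $ b\<close> satisfy linear relations, such as \<open>1 * y\<^sup>2 = y * y\<close>. In particular their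
  rank is not an invariant of the polynomial, and "the Gram matrix of \<open>p\<close> has rank at least \<open>k\<close>" is
  rendered as "\<open>p\<close> has a Gram matrix of rank at least \<open>k\<close>". A lower bound \<open>N - 1\<close> on the rank of
  \<^emph>\<open>every\<close> Gram matrix of the polynomial \<open>q\<close> of the completion problem does not hold. For
  \<open>n = m = 1\<close>, \<open>\<Lambda> = {(0, 0)}\<close>, \<open>z\<^sub>0 = 1\<close> (so \<open>u = (1, y, y\<^sup>2)\<close>, \<open>N = 3\<close>, \<open>h\<^sub>1 = y - 1\<close>), \<open>\<rho> = -4\<close> and
  \<open>\<lambda>\<^sub>1 = 3 y\<^sup>2 - 10 y + 10 = 3 (y - 5/3)\<^sup>2 + 5/3\<close>,

    \<open>q = (y - 1)\<^sup>2 + (y\<^sup>2 - 1)\<^sup>2 + 4 + (y - 1)\<^sup>2 (3 y\<^sup>2 - 10 y + 10) = (2 y\<^sup>2 - 4 y + 4)\<^sup>2\<close>,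

  which has the Gram matrix \<open>v v\<^sup>T\<close> with \<open>v = (4, -4, 2)\<close>, of rank \<open>1 < N - 1\<close>.
\<close>

definition is_gram_matrix :: "real_mpoly vec \<Rightarrow> real_mpoly \<Rightarrow> real mat \<Rightarrow> bool" where
  "is_gram_matrix u p W \<longleftrightarrow> W \<in> psd_mats (dim_vec u) \<and> quad_form u W = p"

text \<open>\<open>z = (x\<^sub>2, \<dots>, x\<^sub>n, y\<^sub>1, \<dots>, y\<^sub>m)\<close>, with \<open>x\<^sub>1\<close> replaced by \<open>1\<close>.\<close>

definition x_poly :: "nat \<Rightarrow> real_mpoly" where
  "x_poly i = (if i = 0 then 1 else Var (i - 1))"

definition y_poly :: "nat \<Rightarrow> nat \<Rightarrow> real_mpoly" where
  "y_poly n j = Var (n - 1 + j)"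

definition true_value :: "real vec \<Rightarrow> real vec \<Rightarrow> real vec" where
  "true_value x0 y0 =
     vec (dim_vec x0 - 1 + dim_vec y0)
       (\<lambda>k. if k < dim_vec x0 - 1 then x0 $ (k + 1) else y0 $ (k - (dim_vec x0 - 1)))"

fun data_poly :: "real vec \<Rightarrow> real vec \<Rightarrow> nat \<times> nat \<Rightarrow> real_mpoly" where
  "data_poly x0 y0 (i, j) = x_poly i * y_poly (dim_vec x0) j - Const (x0 $ i * y0 $ j)"

definition outer_prod :: "real vec \<Rightarrow> real vec \<Rightarrow> real mat" where
  "outer_prod x y = mat (dim_vec x) (dim_vec y) (\<lambda>(i, j). x $ i * y $ j)"

text \<open>The matrix \<open>Q\<^sup>r\<close>, where \<open>zi r\<close> and \<open>zj r\<close> are the monomials \<open>z\<^bsub>i(r)\<^esub>\<close> and \<open>z\<^bsub>j(r)\<^esub>\<close>.\<close>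

definition Qr_mat ::
  "nat \<Rightarrow> real vec \<Rightarrow> (nat \<Rightarrow> real_mpoly) \<Rightarrow> (nat \<Rightarrow> real_mpoly) \<Rightarrow> nat \<Rightarrow> real mat" where
  "Qr_mat N z0 zi zj r = mat N N (\<lambda>(a, b).
     if a = 0 \<and> b = 0 then (poly_eval z0 (zi r))\<^sup>2 * (poly_eval z0 (zj r))\<^sup>2
     else if a = 0 \<and> b = r \<or> a = r \<and> b = 0 then - (poly_eval z0 (zi r) * poly_eval z0 (zj r))
     else if a = r \<and> b = r then 1
     else 0)"

definition Q_mat ::
  "nat \<Rightarrow> real vec \<Rightarrow> (nat \<Rightarrow> real_mpoly) \<Rightarrow> (nat \<Rightarrow> real_mpoly) \<Rightarrow> real mat" where
  "Q_mat N z0 zi zj = mat N N (\<lambda>ab. \<Sum>r = 1..<N. Qr_mat N z0 zi zj r $$ ab)"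

text \<open>The polynomial \<open>q(z; Q; \<rho>, \<lambda>)\<close>; the data polynomials \<open>h\<^sub>k\<close> and the multipliers \<open>\<lambda>\<^sub>k\<close> are indexed
  by the elements of \<open>\<Lambda>\<close> itself.\<close>

definition q_poly ::
  "real_mpoly vec \<Rightarrow> real mat \<Rightarrow> real \<Rightarrow> 'k set \<Rightarrow> ('k \<Rightarrow> real_mpoly) \<Rightarrow> ('k \<Rightarrow> real_mpoly) \<Rightarrow> real_mpoly"
  where
  "q_poly u Q \<rho> \<Lambda> h lam = quad_form u Q - Const \<rho> + (\<Sum>k\<in>\<Lambda>. (h k)\<^sup>2 * lam k)"

end

theory Submission
  imports Defs
begin

text \<open>
  Evaluating at \<open>z\<^sub>0\<close> kills every \<open>h\<^sub>k\<close> and the form of \<open>Q\<close>, so \<open>q(z\<^sub>0) = -\<rho> \<ge> 0\<close>. Therefore \<open>-\<rho>\<close> and all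
  \<open>h\<^sub>k\<^sup>2 \<lambda>\<^sub>k\<close> have Gram matrices of their own, and the sum \<open>\<Gamma>\<close> of these with \<open>Q\<close> satisfies
  \<open>v\<^sup>T \<Gamma> v \<ge> v\<^sup>T Q v = \<Sum>\<^sub>r (v\<^sub>r - u\<^sub>r(z\<^sub>0) v\<^sub>1)\<^sup>2\<close>. This is positive for \<open>v \<noteq> 0\<close> with \<open>v\<^sub>1 = 0\<close>, so the last
  \<open>N - 1\<close> columns of \<open>\<Gamma>\<close> are linearly independent.
\<close>

section \<open>Degrees and closure properties of polynomials\<close>

lemma exponent_degree_add: "exponent_degree (a + b) = exponent_degree a + exponent_degree b"
  unfolding exponent_degree_def by (rule setsum_keys_plus_distrib) simp_all

lemma exponent_degree_zero [simp]: "exponent_degree 0 = 0"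
  by (simp add: exponent_degree_def)

lemma exponent_degree_single [simp]: "exponent_degree (Poly_Mapping.single i k) = k"
  by (simp add: exponent_degree_def)

text \<open>Because \<open>0\<close> is inserted under \<open>Max\<close>, the equivalence also
  covers the zero polynomial, and degree bounds become statements about keys.\<close>

lemma total_degree_le_iff:
  "total_degree p \<le> d \<longleftrightarrow> (\<forall>t\<in>Poly_Mapping.keys p. exponent_degree t \<le> d)"
  by (simp add: total_degree_def)

lemma total_degree_mult_le: "total_degree (p * q) \<le> total_degree p + total_degree q"
  unfolding total_degree_le_iff
proof
  fix t assume "t \<in> Poly_Mapping.keys (p * q)"
  then obtain a b where "t = a + b" "a \<in> Poly_Mapping.keys p" "b \<in> Poly_Mapping.keys q"
    using keys_mult[of p q] by blast
  then show "exponent_degree t \<le> total_degree p + total_degree q"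
    using total_degree_le_iff[of p "total_degree p"] total_degree_le_iff[of q "total_degree q"]
    by (simp add: exponent_degree_add add_mono)
qed

lemma total_degree_diff_le:
  assumes "total_degree p \<le> d" "total_degree q \<le> d"
  shows "total_degree (p - q) \<le> d"
  using assms keys_diff[of p q] unfolding total_degree_le_iff by blast

lemma polys_mult:
  assumes "p \<in> polys s" "q \<in> polys s"
  shows "p * q \<in> polys s"
  unfolding polys_def
proof clarify
  fix t i assume "t \<in> Poly_Mapping.keys (p * q)" and i: "i \<in> Poly_Mapping.keys t"
  then obtain a b where "t = a + b" "a \<in> Poly_Mapping.keys p" "b \<in> Poly_Mapping.keys q"
    using keys_mult[of p q] by blast
  then show "i < s"
    using assms i keys_add[of a b] unfolding polys_def by blast
qed

lemma polys_diff: "p \<in> polys s \<Longrightarrow> q \<in> polys s \<Longrightarrow> p - q \<in> polys s"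
  using keys_diff[of p q] unfolding polys_def by blast

lemma Const_in_polys: "Const c \<in> polys s"
  by (simp add: Const_def polys_def)

lemma Var_in_polys: "i < s \<Longrightarrow> Var i \<in> polys s"
  by (simp add: Var_def polys_def)

lemma total_degree_Const [simp]: "total_degree (Const c) = 0"
  by (simp add: Const_def total_degree_def)

lemma total_degree_Var [simp]: "total_degree (Var i) = 1"
  by (simp add: Var_def total_degree_def)

lemma Const_1: "Const 1 = 1"
  by (simp add: Const_def)

lemma Const_add: "Const (a + b) = Const a + Const b"
  by (simp add: Const_def single_add)

lemma Const_mult: "Const (a * b) = Const a * Const b"
  by (simp add: Const_def mult_single)

section \<open>Monomial expansion and evaluation as a ring homomorphism\<close>

lemma poly_mapping_eq_sum_single:
  assumes "finite T" "Poly_Mapping.keys p \<subseteq> T"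
  shows "p = (\<Sum>t\<in>T. Poly_Mapping.single t (Poly_Mapping.lookup p t))"
proof (rule poly_mapping_eqI)
  fix k
  have "(\<Sum>t\<in>T. Poly_Mapping.lookup (Poly_Mapping.single t (Poly_Mapping.lookup p t)) k) =
      (\<Sum>t\<in>T. if t = k then Poly_Mapping.lookup p k else 0)"
    by (rule sum.cong) (auto simp: lookup_single when_def)
  then show "Poly_Mapping.lookup p k =
      Poly_Mapping.lookup (\<Sum>t\<in>T. Poly_Mapping.single t (Poly_Mapping.lookup p t)) k"
    using assms by (auto simp: lookup_sum in_keys_iff)
qed

text \<open>All three products can be taken over the union of the two supports, since a variable
  with exponent \<open>0\<close> contributes the factor \<open>1\<close>; there the exponents simply
  add.\<close>

lemma monom_eval_add:
  fixes z :: "real vec"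
  shows "(\<Prod>i\<in>Poly_Mapping.keys (a + b). z $ i ^ Poly_Mapping.lookup (a + b) i) =
    (\<Prod>i\<in>Poly_Mapping.keys a. z $ i ^ Poly_Mapping.lookup a i) *
    (\<Prod>i\<in>Poly_Mapping.keys b. z $ i ^ Poly_Mapping.lookup b i)"
proof -
  let ?S = "Poly_Mapping.keys a \<union> Poly_Mapping.keys b"
  have ext: "(\<Prod>i\<in>Poly_Mapping.keys t. z $ i ^ Poly_Mapping.lookup t i) =
      (\<Prod>i\<in>?S. z $ i ^ Poly_Mapping.lookup t i)" if "Poly_Mapping.keys t \<subseteq> ?S" for t
    using that by (intro prod.mono_neutral_left) (auto simp: in_keys_iff)
  show ?thesis
    by (simp only: ext[OF keys_add] ext[OF Un_upper1] ext[OF Un_upper2])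
      (simp add: lookup_add power_add prod.distrib)
qed

text \<open>Terms outside \<open>keys p\<close> have coefficient \<open>0\<close>. The freedom in
  \<open>T\<close> lets several polynomials be evaluated over one common index set.\<close>

lemma poly_eval_superset:
  assumes "finite T" "Poly_Mapping.keys p \<subseteq> T"
  shows "poly_eval z p = (\<Sum>t\<in>T. Poly_Mapping.lookup p t *
    (\<Prod>i\<in>Poly_Mapping.keys t. z $ i ^ Poly_Mapping.lookup t i))"
  unfolding poly_eval_def using assms
  by (intro sum.mono_neutral_left) (auto simp: in_keys_iff)

lemma poly_eval_add: "poly_eval z (p + q) = poly_eval z p + poly_eval z q"
proof -
  let ?T = "Poly_Mapping.keys p \<union> Poly_Mapping.keys q"
  show ?thesis
    using keys_add[of p q]
    by (simp add: poly_eval_superset[of ?T] lookup_add distrib_right sum.distrib)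
qed

lemma poly_eval_zero [simp]: "poly_eval z 0 = 0"
  by (simp add: poly_eval_def)

lemma poly_eval_diff: "poly_eval z (p - q) = poly_eval z p - poly_eval z q"
  using poly_eval_add[of z "p - q" q] by simp

lemma poly_eval_sum: "poly_eval z (\<Sum>x\<in>A. f x) = (\<Sum>x\<in>A. poly_eval z (f x))"
  by (induction A rule: infinite_finite_induct) (simp_all add: poly_eval_add)

lemma poly_eval_single:
  "poly_eval z (Poly_Mapping.single t c) =
    c * (\<Prod>i\<in>Poly_Mapping.keys t. z $ i ^ Poly_Mapping.lookup t i)"
  by (simp add: poly_eval_superset[of "{t}"])

lemma poly_eval_Const [simp]: "poly_eval z (Const c) = c"
  by (simp add: Const_def poly_eval_single)

lemma poly_eval_one [simp]: "poly_eval z 1 = 1"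
  using poly_eval_Const[of z 1] by (simp add: Const_1)

lemma poly_eval_Var [simp]: "poly_eval z (Var i) = z $ i"
  by (simp add: Var_def poly_eval_single)

text \<open>Expanding both factors into single terms reduces multiplicativity to
  \<open>monom_eval_add\<close>.\<close>

lemma poly_eval_mult: "poly_eval z (p * q) = poly_eval z p * poly_eval z q"
proof -
  let ?s = "\<lambda>p t. Poly_Mapping.single t (Poly_Mapping.lookup p t) :: real_mpoly"
  have "p * q = (\<Sum>a\<in>Poly_Mapping.keys p. ?s p a) * (\<Sum>b\<in>Poly_Mapping.keys q. ?s q b)"
    by (metis poly_mapping_eq_sum_single finite_keys order_refl)
  also have "\<dots> = (\<Sum>a\<in>Poly_Mapping.keys p. \<Sum>b\<in>Poly_Mapping.keys q.
      Poly_Mapping.single (a + b) (Poly_Mapping.lookup p a * Poly_Mapping.lookup q b))"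
    by (simp add: sum_product mult_single)
  finally show ?thesis
    by (simp add: poly_eval_sum poly_eval_single monom_eval_add)
      (simp add: poly_eval_def sum_product mult_ac)
qed

lemma poly_eval_power2: "poly_eval z (p\<^sup>2) = (poly_eval z p)\<^sup>2"
  by (simp add: power2_eq_square poly_eval_mult)

lemma poly_eval_sos_nonneg:
  assumes "p \<in> sos_polys s"
  shows "poly_eval z p \<ge> 0"
proof -
  obtain qs where "p = (\<Sum>q\<leftarrow>qs. q\<^sup>2)"
    using assms unfolding sos_polys_def by blast
  moreover have "poly_eval z (\<Sum>q\<leftarrow>qs. q\<^sup>2) \<ge> 0"
    by (induction qs) (simp_all add: poly_eval_add poly_eval_power2)
  ultimately show ?thesis by simp
qed

section \<open>Quadratic forms and the construction of Gram matrices\<close>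

text \<open>The type is a general commutative semiring so that the expansion serves real vectors and
  vectors of polynomials alike.\<close>

lemma quadratic_form_eq_sum:
  fixes v :: "'a :: comm_semiring_1 vec"
  assumes "v \<in> carrier_vec n" "A \<in> carrier_mat n n"
  shows "v \<bullet> (A *\<^sub>v v) = (\<Sum>i<n. \<Sum>j<n. A $$ (i, j) * (v $ i * v $ j))"
  using assms
  by (auto simp: scalar_prod_def atLeast0LessThan sum_distrib_left mult_ac intro!: sum.cong)

lemma quad_form_eq_sum:
  assumes "u \<in> carrier_vec N" "W \<in> carrier_mat N N"
  shows "quad_form u W = (\<Sum>i<N. \<Sum>j<N. Const (W $$ (i, j)) * (u $ i * u $ j))"
proof -
  have "map_mat Const W \<in> carrier_mat N N"
    using assms by simp
  from quadratic_form_eq_sum[OF assms(1) this] show ?thesis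
    using assms by (simp add: quad_form_def)
qed

lemma poly_eval_quad_form:
  assumes "u \<in> carrier_vec N" "W \<in> carrier_mat N N"
  shows "poly_eval z (quad_form u W) =
    vec N (\<lambda>i. poly_eval z (u $ i)) \<bullet> (W *\<^sub>v vec N (\<lambda>i. poly_eval z (u $ i)))"
  using assms
  by (simp add: quad_form_eq_sum quadratic_form_eq_sum[of _ N] poly_eval_sum poly_eval_mult)

lemma is_gram_matrix_add:
  assumes p: "is_gram_matrix u p A" and q: "is_gram_matrix u q B"
  shows "is_gram_matrix u (p + q) (A + B)"
proof -
  let ?N = "dim_vec u"
  have A: "A \<in> carrier_mat ?N ?N" and B: "B \<in> carrier_mat ?N ?N"
    using p q by (auto simp: is_gram_matrix_def psd_mats_def)
  have "transpose_mat (A + B) = A + B"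
    using p q transpose_add[OF A B] by (simp add: is_gram_matrix_def psd_mats_def)
  moreover have "0 \<le> v \<bullet> ((A + B) *\<^sub>v v)" if v: "v \<in> carrier_vec ?N" for v
    using p q v A B
    by (simp add: add_mult_distrib_mat_vec[OF A B v] scalar_prod_add_distrib[of _ ?N]
        is_gram_matrix_def psd_mats_def)
  moreover have "quad_form u (A + B) = quad_form u A + quad_form u B"
    using A B
    by (simp add: quad_form_eq_sum[of _ ?N] Const_add distrib_right sum.distrib)
  ultimately show ?thesis
    using p q A B by (simp add: is_gram_matrix_def psd_mats_def)
qed

lemma is_gram_matrix_zero: "is_gram_matrix u 0 (0\<^sub>m (dim_vec u) (dim_vec u))"
  by (auto simp: is_gram_matrix_def psd_mats_def quad_form_eq_sum[of _ "dim_vec u"]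
      quadratic_form_eq_sum[of _ "dim_vec u"] Const_def)

text \<open>If \<open>w\<close> is the coefficient vector of \<open>p\<close> with respect to
  \<open>u\<close>, then the outer product of \<open>w\<close> with itself represents the square of
  \<open>p\<close>, and its form at \<open>v\<close> is the square of the scalar product of
  \<open>w\<close> and \<open>v\<close>.\<close>

lemma is_gram_matrix_square:
  assumes p: "p = (\<Sum>r<dim_vec u. Const (w r) * u $ r)"
  shows "is_gram_matrix u (p\<^sup>2) (mat (dim_vec u) (dim_vec u) (\<lambda>(i, j). w i * w j))"
    (is "is_gram_matrix u _ ?W")
proof -
  let ?N = "dim_vec u"
  have "v \<bullet> (?W *\<^sub>v v) = (\<Sum>i<?N. w i * v $ i)\<^sup>2" if "v \<in> carrier_vec ?N" for v
    using that
    by (simp add: quadratic_form_eq_sum[of _ ?N] power2_eq_square sum_product mult_ac)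
  moreover have "quad_form u ?W = p\<^sup>2"
    by (simp add: quad_form_eq_sum[of _ ?N] p power2_eq_square sum_product Const_mult mult_ac)
  moreover have "transpose_mat ?W = ?W"
    by (rule eq_matI) (simp_all add: mult.commute)
  ultimately show ?thesis
    by (simp add: is_gram_matrix_def psd_mats_def)
qed

lemma poly_eq_sum_monomials:
  assumes bij: "bij_betw (\<lambda>r. u $ r) {..<N} (monomials_upto s d)"
    and p: "p \<in> polys s" "total_degree p \<le> d"
  obtains w where "p = (\<Sum>r<N. Const (w r) * u $ r)"
proof -
  define T :: "(nat \<Rightarrow>\<^sub>0 nat) set"
    where "T = {t. Poly_Mapping.keys t \<subseteq> {..<s} \<and> exponent_degree t \<le> d}"
  define e :: "(nat \<Rightarrow>\<^sub>0 nat) \<Rightarrow> real_mpoly" where "e = (\<lambda>t. Poly_Mapping.single t 1)"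
  \<comment> \<open>The exponent is recovered from its monomial: the coefficient \<open>1\<close> is
    nonzero, so the key set of \<open>e t\<close> is exactly \<open>{t}\<close>.\<close>
  have "inj e"
  proof (rule injI)
    fix a b assume "e a = e b"
    then have "Poly_Mapping.keys (e a) = Poly_Mapping.keys (e b)" by simp
    then show "a = b" by (simp add: e_def)
  qed
  moreover have im: "e ` T = monomials_upto s d"
    by (auto simp: e_def T_def monomials_upto_def)
  ultimately have e: "bij_betw e T (monomials_upto s d)"
    by (auto simp: bij_betw_def inj_on_def)
  \<comment> \<open>\<open>\<tau> r\<close> is the exponent vector of the monomial
    \<open>u $ r\<close>, so the enumeration of monomials by \<open>u\<close> becomes one of
    exponents.\<close>
  define \<tau> where "\<tau> = inv_into T e \<circ> (\<lambda>r. u $ r)"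
  have \<tau>: "bij_betw \<tau> {..<N} T"
    unfolding \<tau>_def using bij bij_betw_inv_into[OF e] by (rule bij_betw_trans)
  have u: "u $ r = Poly_Mapping.single (\<tau> r) 1" if "r < N" for r
  proof -
    have "u $ r \<in> e ` T"
      using that bij im by (auto simp: bij_betw_def)
    then show ?thesis
      using f_inv_into_f[of "u $ r" e T] by (simp add: \<tau>_def e_def)
  qed
  \<comment> \<open>Finiteness is transported from \<open>{..<N}\<close> along the bijection instead
    of being obtained by counting exponents.\<close>
  have "finite T"
    using \<tau> bij_betw_finite by blast
  moreover have "Poly_Mapping.keys p \<subseteq> T"
    using p by (auto simp: T_def polys_def total_degree_le_iff)
  ultimately have "p = (\<Sum>t\<in>T. Poly_Mapping.single t (Poly_Mapping.lookup p t))"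
    by (rule poly_mapping_eq_sum_single)
  also have "\<dots> = (\<Sum>r<N. Poly_Mapping.single (\<tau> r) (Poly_Mapping.lookup p (\<tau> r)))"
    by (rule sum.reindex_bij_betw[OF \<tau>, symmetric])
  also have "\<dots> = (\<Sum>r<N. Const (Poly_Mapping.lookup p (\<tau> r)) * u $ r)"
    by (rule sum.cong) (simp_all add: u Const_def mult_single)
  finally show thesis by (rule that)
qed

text \<open>Gram matrices add along the sum. A sum over an infinite set is \<open>0\<close> by
  convention, so the zero matrix serves there as it does for the empty set.\<close>

lemma ex_gram_matrix_sum:
  assumes "\<And>k. k \<in> A \<Longrightarrow> \<exists>W. is_gram_matrix u (f k) W"
  shows "\<exists>W. is_gram_matrix u (\<Sum>k\<in>A. f k) W"
  using assms
  by (induction A rule: infinite_finite_induct)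
    (auto intro: is_gram_matrix_zero, blast intro: is_gram_matrix_add)

text \<open>Multiplying \<open>h\<^sup>2\<close> into the sum of squares gives the squares of the
  products \<open>h * q\<close>. Since \<open>total_degree h \<le> d\<close>, the natural-number
  subtraction does not truncate, so each \<open>h * q\<close> has degree at most \<open>d\<close>
  and is a combination of the entries of \<open>u\<close>.\<close>

lemma ex_gram_matrix_square_mult_sos:
  assumes bij: "bij_betw (\<lambda>r. u $ r) {..<dim_vec u} (monomials_upto s d)"
    and h: "h \<in> polys s" "total_degree h \<le> d"
    and l: "l \<in> sos_polys_deg s (2 * d - 2 * total_degree h)"
  shows "\<exists>W. is_gram_matrix u (h\<^sup>2 * l) W"
proof -
  obtain qs where qs: "set qs \<subseteq> {q \<in> polys s. 2 * total_degree q \<le> 2 * d - 2 * total_degree h}"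
    and l: "l = (\<Sum>q\<leftarrow>qs. q\<^sup>2)"
    using l unfolding sos_polys_deg_def by blast
  have "\<exists>W. is_gram_matrix u (h\<^sup>2 * (\<Sum>q\<leftarrow>qs. q\<^sup>2)) W"
    using qs
  proof (induction qs)
    case Nil
    then show ?case using is_gram_matrix_zero by auto
  next
    case (Cons q qs)
    have "total_degree (h * q) \<le> d"
      using total_degree_mult_le[of h q] Cons.prems h by auto
    moreover have "h * q \<in> polys s"
      using Cons.prems h by (auto intro: polys_mult)
    ultimately obtain w where "h * q = (\<Sum>r<dim_vec u. Const (w r) * u $ r)"
      using poly_eq_sum_monomials[OF bij] by blast
    from is_gram_matrix_square[OF this] obtain W where "is_gram_matrix u ((h * q)\<^sup>2) W"
      by blast
    moreover obtain W' where "is_gram_matrix u (h\<^sup>2 * (\<Sum>q\<leftarrow>qs. q\<^sup>2)) W'"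
      using Cons by auto
    ultimately have "is_gram_matrix u ((h * q)\<^sup>2 + h\<^sup>2 * (\<Sum>q\<leftarrow>qs. q\<^sup>2)) (W + W')"
      by (rule is_gram_matrix_add)
    then show ?case
      by (auto simp: power_mult_distrib distrib_left)
  qed
  then show ?thesis by (simp add: l)
qed

section \<open>The quadratic form of \<open>Q\<close>\<close>

lemma Q_mat_carrier: "Q_mat N z zi zj \<in> carrier_mat N N"
  by (simp add: Q_mat_def)

lemma Qr_mat_quadratic_form:
  assumes r: "0 < r" "r < N"
  shows "(\<Sum>i<N. \<Sum>j<N. Qr_mat N z zi zj r $$ (i, j) * (v $ i * v $ j)) =
    (v $ r - poly_eval z (zi r) * poly_eval z (zj r) * v $ 0)\<^sup>2"
proof -
  define c where "c = poly_eval z (zi r) * poly_eval z (zj r)"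
  \<comment> \<open>The matrix is the outer product of \<open>w\<close> with itself, where
    \<open>w\<close> is the unit vector at \<open>r\<close> minus \<open>c\<close> times the unit
    vector at \<open>0\<close>. As \<open>0 < r\<close>, the two nonzero positions are
    different.\<close>
  define w where "w i = (if i = r then 1 else if i = 0 then - c else 0)" for i
  have "(\<Sum>i<N. \<Sum>j<N. Qr_mat N z zi zj r $$ (i, j) * (v $ i * v $ j)) =
      (\<Sum>i<N. \<Sum>j<N. (w i * v $ i) * (w j * v $ j))"
    using r by (intro sum.cong refl) (auto simp: Qr_mat_def w_def c_def power2_eq_square)
  also have "\<dots> = (\<Sum>i<N. w i * v $ i)\<^sup>2"
    by (simp add: power2_eq_square sum_product)
  also have "(\<Sum>i<N. w i * v $ i) =
      (\<Sum>i<N. (if i = r then v $ r else 0) + (if i = 0 then - c * v $ 0 else 0))"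
    using r by (intro sum.cong) (auto simp: w_def)
  also have "\<dots> = v $ r - c * v $ 0"
    using r by (simp add: sum.distrib)
  finally show ?thesis by (simp add: c_def)
qed

lemma Q_mat_quadratic_form:
  assumes v: "v \<in> carrier_vec N"
  shows "v \<bullet> (Q_mat N z zi zj *\<^sub>v v) =
    (\<Sum>r = 1..<N. (v $ r - poly_eval z (zi r) * poly_eval z (zj r) * v $ 0)\<^sup>2)"
proof -
  have "v \<bullet> (Q_mat N z zi zj *\<^sub>v v) =
      (\<Sum>i<N. \<Sum>j<N. \<Sum>r = 1..<N. Qr_mat N z zi zj r $$ (i, j) * (v $ i * v $ j))"
    using v by (simp add: quadratic_form_eq_sum[of _ N] Q_mat_carrier)
      (simp add: Q_mat_def sum_distrib_right)
  also have "\<dots> = (\<Sum>r = 1..<N. \<Sum>i<N. \<Sum>j<N. Qr_mat N z zi zj r $$ (i, j) * (v $ i * v $ j))"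
    by (subst sum.swap[of _ "{1..<N}"])
      (simp only: sum.swap[of _ "{..<N}" "{1..<N}"])
  also have "\<dots> = (\<Sum>r = 1..<N. (v $ r - poly_eval z (zi r) * poly_eval z (zj r) * v $ 0)\<^sup>2)"
    by (rule sum.cong) (simp_all add: Qr_mat_quadratic_form)
  finally show ?thesis .
qed

lemma Q_mat_psd: "Q_mat N z zi zj \<in> psd_mats N"
proof -
  have "transpose_mat (Q_mat N z zi zj) = Q_mat N z zi zj"
    by (rule eq_matI) (auto simp: Q_mat_def Qr_mat_def intro!: sum.cong)
  then show ?thesis
    by (simp add: psd_mats_def Q_mat_carrier Q_mat_quadratic_form sum_nonneg)
qed

section \<open>A rank bound from injectivity on a hyperplane\<close>

text \<open>Injectivity on the vectors with entry \<open>0\<close> equal to zero means that the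
  columns of \<open>A\<close> other than the first are linearly independent, and the rank is at
  least the size of an independent set of columns.\<close>

lemma rank_ge_minus_one:
  fixes A :: "'a :: field mat"
  assumes A: "A \<in> carrier_mat N N"
    and inj: "\<And>v. v \<in> carrier_vec N \<Longrightarrow> v $ 0 = 0 \<Longrightarrow> A *\<^sub>v v = 0\<^sub>v N \<Longrightarrow> v = 0\<^sub>v N"
  shows "N - 1 \<le> vec_space.rank N A"
proof (cases N)
  case 0
  then show ?thesis by simp
next
  case (Suc M)
  interpret vec_space "TYPE('a)" N .
  define B where "B = mat N M (\<lambda>(i, j). A $$ (i, Suc j))"
  have B: "B \<in> carrier_mat N M"
    by (simp add: B_def)
  have kernel: "w = 0\<^sub>v M" if w: "w \<in> carrier_vec M" and Bw: "B *\<^sub>v w = 0\<^sub>v N" for w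
  proof -
    \<comment> \<open>A leading zero switches off the first column of \<open>A\<close>, which is the
      one that \<open>B\<close> omits.\<close>
    have "A *\<^sub>v vCons 0 w = B *\<^sub>v w"
    proof (rule eq_vecI)
      fix i assume "i < dim_vec (B *\<^sub>v w)"
      then have "i < N" using B by simp
      then show "(A *\<^sub>v vCons 0 w) $ i = (B *\<^sub>v w) $ i"
        using A w by (simp add: B_def scalar_prod_def Suc sum.atLeast0_lessThan_Suc_shift
            del: sum.op_ivl_Suc)
    qed (use A B in simp)
    moreover have "vCons 0 w \<in> carrier_vec N"
      using w Suc by simp
    ultimately have 0: "vCons 0 w = 0\<^sub>v N"
      using inj[of "vCons 0 w"] Bw by simp
    show ?thesis
    proof (rule eq_vecI)
      fix i assume "i < dim_vec (0\<^sub>v M :: 'a vec)"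
      then show "w $ i = 0\<^sub>v M $ i"
        using arg_cong[OF 0, of "\<lambda>v. v $ Suc i"] Suc by simp
    qed (use w in simp)
  qed
  \<comment> \<open>Independence is a property of the set of columns, so repetitions must be
    excluded to count \<open>M\<close> of them: two equal columns would put the difference of two
    unit vectors into the kernel of \<open>B\<close>.\<close>
  have distinct: "distinct (cols B)"
    unfolding distinct_conv_nth
  proof (intro allI impI notI)
    fix i j assume i: "i < length (cols B)" and j: "j < length (cols B)"
      and "i \<noteq> j" and eq: "cols B ! i = cols B ! j"
    have "i < M" "j < M"
      using i j B by simp_all
    have unit: "B *\<^sub>v unit_vec M k = col B k" if "k < M" for k
      using B that by (intro eq_vecI) auto
    have "B *\<^sub>v (unit_vec M i - unit_vec M j) = col B i - col B j"
      using \<open>i < M\<close> \<open>j < M\<close> by (simp add: mult_minus_distrib_mat_vec[OF B] unit)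
    also have "\<dots> = 0\<^sub>v N"
      using eq B \<open>i < M\<close> \<open>j < M\<close> by simp
    finally have "unit_vec M i - unit_vec M j = (0\<^sub>v M :: 'a vec)"
      by (intro kernel) simp_all
    from arg_cong[OF this, of "\<lambda>v. v $ i"] show False
      using \<open>i < M\<close> \<open>j < M\<close> \<open>i \<noteq> j\<close> by simp
  qed
  \<comment> \<open>A dependency among distinct columns would yield a nonzero kernel vector of
    \<open>B\<close>.\<close>
  have "lin_indpt (set (cols B))"
    using lin_depE[OF B _ distinct] kernel by metis
  moreover have "set (cols B) \<subseteq> set (cols A)"
  proof
    fix c assume "c \<in> set (cols B)"
    then obtain j where j: "j < M" "c = col B j"
      using B by (auto simp: cols_def)
    then have "c = col A (Suc j)"
      using A Suc by (intro eq_vecI) (auto simp: B_def)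
    moreover have "Suc j < N"
      using j Suc by simp
    ultimately show "c \<in> set (cols A)"
      using A by (auto simp: cols_def)
  qed
  ultimately have "card (set (cols B)) \<le> rank A"
    using rank_ge_card_indpt[OF A] by blast
  then show ?thesis
    using distinct B Suc by (simp add: distinct_card)
qed

section \<open>Degree and vanishing of the data polynomials\<close>

lemma data_poly_in_polys:
  assumes "x0 \<in> carrier_vec n" "i < n" "j < m"
  shows "data_poly x0 y0 (i, j) \<in> polys (n + m - 1)"
proof -
  have "x_poly i \<in> polys (n + m - 1)"
    using assms Const_in_polys[of 1] by (auto simp: x_poly_def Const_1 intro: Var_in_polys)
  moreover have "y_poly n j \<in> polys (n + m - 1)"
    using assms by (auto simp: y_poly_def intro: Var_in_polys)
  ultimately show ?thesis
    using assms by (auto intro: polys_diff polys_mult Const_in_polys)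
qed

lemma total_degree_data_poly_le: "total_degree (data_poly x0 y0 k) \<le> 2"
proof (cases k)
  case (Pair i j)
  have "total_degree (x_poly i) \<le> 1"
    using total_degree_Const[of 1] by (simp add: x_poly_def Const_1)
  then have "total_degree (x_poly i * y_poly (dim_vec x0) j) \<le> 2"
    using total_degree_mult_le[of "x_poly i" "y_poly (dim_vec x0) j"] by (simp add: y_poly_def)
  then show ?thesis
    by (simp add: Pair total_degree_diff_le)
qed

text \<open>The normalisation \<open>x0 $ 0 = 1\<close> matches the convention that
  \<open>x_poly 0\<close> is the constant \<open>1\<close>; the other factors are variables whose
  values at the true point are the entries of \<open>x0\<close> and \<open>y0\<close>.\<close>

lemma poly_eval_data_poly:
  assumes "x0 \<in> carrier_vec n" "y0 \<in> carrier_vec m" "x0 $ 0 = 1" "i < n" "j < m"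
  shows "poly_eval (true_value x0 y0) (data_poly x0 y0 (i, j)) = 0"
proof -
  have "poly_eval (true_value x0 y0) (x_poly i) = x0 $ i"
    using assms by (auto simp: x_poly_def true_value_def)
  moreover have "poly_eval (true_value x0 y0) (y_poly n j) = y0 $ j"
    using assms by (auto simp: y_poly_def true_value_def)
  ultimately show ?thesis
    using assms by (simp add: poly_eval_diff poly_eval_mult)
qed

section \<open>A Gram matrix with large rank for the completion polynomial\<close>

theorem theorem4p4:
  fixes n m s N :: nat
    and x0 y0 z0 :: "real vec"
    and \<Lambda> :: "(nat \<times> nat) set"
    and h lam :: "nat \<times> nat \<Rightarrow> real_mpoly"
    and u :: "real_mpoly vec"
    and zi zj :: "nat \<Rightarrow> real_mpoly"
    and Q :: "real mat"
    and \<rho> :: real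
  assumes "n \<ge> 1" and "m \<ge> 1"
    and s_def: "s = n + m - 1"
    and N_def: "N = (s + 2) choose 2"
    and "x0 \<in> carrier_vec n" and "x0 $ 0 = 1"
    and "y0 \<in> carrier_vec m"
    and "vec_space.rank n (outer_prod x0 y0) = 1"
    and z0_def: "z0 = true_value x0 y0"
    and "\<Lambda> \<subseteq> {..<n} \<times> {..<m}"
    and h_def: "h = data_poly x0 y0"
    and "u \<in> carrier_vec N"
    and "bij_betw (\<lambda>r. u $ r) {..<N} (monomials_upto s 2)"
    and "u $ 0 = 1"
    and "\<And>r. r < N \<Longrightarrow>
           zi r \<in> monomials_upto s 1 \<and> zj r \<in> monomials_upto s 1 \<and> u $ r = zi r * zj r"
    and Q_def: "Q = Q_mat N z0 zi zj"
    and "\<And>k. k \<in> \<Lambda> \<Longrightarrow> lam k \<in> sos_polys_deg s (4 - 2 * total_degree (h k))"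
    and "q_poly u Q \<rho> \<Lambda> h lam \<in> sos_polys s"
  shows "\<exists>\<Gamma>. is_gram_matrix u (q_poly u Q \<rho> \<Lambda> h lam) \<Gamma> \<and> vec_space.rank N \<Gamma> \<ge> N - 1"
proof -
  have dim: "dim_vec u = N"
    using \<open>u \<in> carrier_vec N\<close> by simp
  have N: "N > 0"
    by (simp add: N_def)
  have Q: "Q \<in> carrier_mat N N"
    by (simp add: Q_def Q_mat_carrier)
  let ?R = "\<Sum>k\<in>\<Lambda>. (h k)\<^sup>2 * lam k"
  let ?c = "vec N (\<lambda>i. poly_eval z0 (u $ i))"
  have c: "poly_eval z0 (zi r) * poly_eval z0 (zj r) = ?c $ r" if "r < N" for r
    using that assms(15)[of r] by (simp add: poly_eval_mult)
  \<comment> \<open>Entry \<open>0\<close> of \<open>?c\<close> is \<open>1\<close>, so each square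
    in the form of \<open>Q\<close> at \<open>?c\<close> has base
    \<open>?c $ r - ?c $ r * 1 = 0\<close>.\<close>
  have "poly_eval z0 (quad_form u Q) = 0"
    unfolding poly_eval_quad_form[OF \<open>u \<in> carrier_vec N\<close> Q]
    by (simp add: Q_def Q_mat_quadratic_form c N \<open>u $ 0 = 1\<close> del: index_vec)
      (simp add: N \<open>u $ 0 = 1\<close>)
  moreover have "poly_eval z0 (h k) = 0" if "k \<in> \<Lambda>" for k
    using that assms by (cases k) (auto simp: poly_eval_data_poly simp del: data_poly.simps)
  then have "poly_eval z0 ?R = 0"
    by (simp add: poly_eval_sum poly_eval_mult poly_eval_power2)
  ultimately have "poly_eval z0 (q_poly u Q \<rho> \<Lambda> h lam) = - \<rho>"
    by (simp add: q_poly_def poly_eval_add poly_eval_diff)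
  then have "\<rho> \<le> 0"
    using poly_eval_sos_nonneg[OF \<open>q_poly u Q \<rho> \<Lambda> h lam \<in> sos_polys s\<close>, of z0] by simp
  have bij: "bij_betw (\<lambda>r. u $ r) {..<dim_vec u} (monomials_upto s 2)"
    using assms(13) dim by simp
  have "\<exists>W. is_gram_matrix u ?R W"
  proof (rule ex_gram_matrix_sum)
    fix k assume k: "k \<in> \<Lambda>"
    obtain i j where "k = (i, j)" "i < n" "j < m"
      using k \<open>\<Lambda> \<subseteq> {..<n} \<times> {..<m}\<close> by blast
    then have "h k \<in> polys s"
      using data_poly_in_polys[OF \<open>x0 \<in> carrier_vec n\<close>] by (simp only: h_def s_def)
    \<comment> \<open>Here \<open>d = 2\<close>, so the admissible degree
      \<open>2 * d - 2 * total_degree (h k)\<close> is the bound assumed for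
      \<open>lam k\<close>.\<close>
    then show "\<exists>W. is_gram_matrix u ((h k)\<^sup>2 * lam k) W"
      using assms(17)[OF k] total_degree_data_poly_le[of x0 y0 k]
      by (intro ex_gram_matrix_square_mult_sos[OF bij]) (simp_all add: h_def)
  qed
  moreover obtain W0 where "is_gram_matrix u (- Const \<rho>) W0"
  proof -
    \<comment> \<open>Since \<open>\<rho> \<le> 0\<close>, the constant \<open>- \<rho>\<close> is
      the square of a real constant, which is itself a combination of the entries of
      \<open>u\<close>.\<close>
    obtain w where w: "Const (sqrt (- \<rho>)) = (\<Sum>r<dim_vec u. Const (w r) * u $ r)"
      using poly_eq_sum_monomials[OF bij Const_in_polys, of "sqrt (- \<rho>)"] by auto
    moreover have "(Const (sqrt (- \<rho>)))\<^sup>2 = - Const \<rho>"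
      using \<open>\<rho> \<le> 0\<close>
      by (simp add: power2_eq_square flip: Const_mult) (simp add: Const_def single_uminus)
    ultimately show thesis
      using is_gram_matrix_square[OF w] by (intro that) simp
  qed
  ultimately obtain W where W: "is_gram_matrix u (- Const \<rho> + ?R) W"
    using is_gram_matrix_add by blast
  have "is_gram_matrix u (quad_form u Q) Q"
    by (simp add: is_gram_matrix_def dim Q_def Q_mat_psd)
  from is_gram_matrix_add[OF this W]
  have gram: "is_gram_matrix u (q_poly u Q \<rho> \<Lambda> h lam) (Q + W)"
    by (simp add: q_poly_def algebra_simps)
  have W_carrier: "W \<in> carrier_mat N N"
    and W_psd: "\<And>v. v \<in> carrier_vec N \<Longrightarrow> 0 \<le> v \<bullet> (W *\<^sub>v v)"
    using W by (auto simp: is_gram_matrix_def psd_mats_def dim)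
  have "N - 1 \<le> vec_space.rank N (Q + W)"
  proof (rule rank_ge_minus_one)
    fix v assume v: "v \<in> carrier_vec N" and "v $ 0 = 0" and ker: "(Q + W) *\<^sub>v v = 0\<^sub>v N"
    \<comment> \<open>Pairing the kernel equation with \<open>v\<close> makes the two forms sum to
      zero. The form of \<open>W\<close> is nonnegative, so that of \<open>Q\<close> is at most
      zero; with \<open>v $ 0 = 0\<close> the latter is just the sum of the squares of the remaining
      entries.\<close>
    have "v \<bullet> (Q *\<^sub>v v) + v \<bullet> (W *\<^sub>v v) = v \<bullet> ((Q + W) *\<^sub>v v)"
      using v Q W_carrier
      by (simp add: add_mult_distrib_mat_vec[OF Q W_carrier v] scalar_prod_add_distrib[of _ N])
    also have "\<dots> = 0"
      using v by (simp add: ker)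
    finally have "(\<Sum>r = 1..<N. (v $ r)\<^sup>2) \<le> 0"
      using W_psd[OF v] \<open>v $ 0 = 0\<close> by (simp add: Q_def Q_mat_quadratic_form[OF v])
    then have "(\<Sum>r = 1..<N. (v $ r)\<^sup>2) = 0"
      by (intro antisym sum_nonneg) auto
    then have "v $ r = 0" if "1 \<le> r" "r < N" for r
      using that by (subst (asm) sum_nonneg_eq_0_iff) auto
    then show "v = 0\<^sub>v N"
      using v \<open>v $ 0 = 0\<close> by (intro eq_vecI) (auto, metis Suc_leI neq0_conv)
  qed (use Q W_carrier in simp)
  with gram show ?thesis by blast
qed

end
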